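(* Let $\mathbb F$ be an algebraically closed field and let $q\in\mathbb F$ be nonzero and not a root of unity. Let $A,B$ denote a Leonard pair over $\mathbb F$ of $q$-Racah type, with feasible sequence $(a,b,c,d)$, $d\ge1$. Then there exists a basis for the underlying vector space $V$, with respect to which $A$ and $B$ are represented by the following tridiagonal matrices in ${\rm Mat}_{d+1}(\mathbb F)$: $$\begin{array}{c|ccc}\text{element}&(n,n-1)\text{-entry}&(n,n)\text{-entry}&(n-1,n)\text{-entry}\\ \hline A&c^{-1}(1-q^{-2n})&(a+a^{-1})q^{d-2n}&c(1-q^{2d-2n+2})\\ B&q^{-d-1}(1-q^{2n})&(b+b^{-1})q^{2n-d}&q^{d+1}(1-q^{2n-2d-2})\end{array}$$ (off-diagonal entries for $1\le n\le d$, diagonal entries for $0\le n\le d$).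
   Context: Matrices in ${\rm Mat}_{d+1}(\mathbb F)$ have rows and columns indexed by $0,\dots,d$; $M$ represents $A$ with respect to a basis $\{v_n\}_{n=0}^d$ when $Av_n=\sum_i M_{in}v_i$. A Leonard pair on a finite-dimensional nonzero $\mathbb F$-vector space $V$ (the underlying vector space) is an ordered pair $A,B\in{\rm End}(V)$ such that there is a basis of $V$ in which $A$ is diagonal and $B$ is irreducible tridiagonal, and a basis in which $B$ is diagonal and $A$ is irreducible tridiagonal (irreducible: all subdiagonal and superdiagonal entries nonzero). For nonzero $a,b,c\in\mathbb F$ and an integer $d\ge1$, $(a,b,c,d)$ is feasible when: (i) neither of $a^2,b^2$ is among $q^{2d-2},q^{2d-4},\dots,q^{2-2d}$; (ii) none of $abc,a^{-1}bc,ab^{-1}c,abc^{-1}$ is among $q^{d-1},q^{d-3},\dots,q^{1-d}$. Put $\theta_n=aq^{2n-d}+a^{-1}q^{d-2n}$, $\theta^*_n=bq^{2n-d}+b^{-1}q^{d-2n}$ ($0\le n\le d$) and, for $1\le n\le d$, $\varphi_n=a^{-1}b^{-1}q^{d+1}(q^n-q^{-n})(q^{n-d-1}-q^{d-n+1})(q^{-n}-abcq^{n-d-1})(q^{-n}-abc^{-1}q^{n-d-1})$, $\phi_n=ab^{-1}q^{d+1}(q^n-q^{-n})(q^{n-d-1}-q^{d-n+1})(q^{-n}-a^{-1}bcq^{n-d-1})(q^{-n}-a^{-1}bc^{-1}q^{n-d-1})$. For feasible $(a,b,c,d)$ there is (known) a Leonard pair $A,B$, unique up to isomorphism (simultaneous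 conjugation by a linear bijection), such that: in one basis $A$ is lower bidiagonal with $(n,n)$-entry $\theta_n$ and all subdiagonal entries $1$, and $B$ is upper bidiagonal with $(n,n)$-entry $\theta^*_n$ and $(n-1,n)$-entry $\varphi_n$; in another basis $A$ is lower bidiagonal with $(n,n)$-entry $\theta_{d-n}$ and all subdiagonal entries $1$, and $B$ is upper bidiagonal with $(n,n)$-entry $\theta_n^*$ and $(n-1,n)$-entry $\phi_n$. This Leonard pair (and any isomorphic one) is said to correspond to $(a,b,c,d)$, and $(a,b,c,d)$ is called a feasible sequence for it. Leonard pairs arising in this way are said to have $q$-Racah type. *)

theory Defs
  imports "HOL-Computational_Algebra.Polynomial" "Jordan_Normal_Form.Matrix"
begin

(* The class alg_closed_field comes from HOL-Computational_Algebra.Polynomial. Matrices in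
   Mat_{d+1} are those of carrier_mat (d + 1) (d + 1); their indices run over 0, ..., d. *)

(* The subdiagonal entry in position (n, n-1) is lo n and the superdiagonal entry in position
   (n-1, n) is up n, for 1 <= n <= d; the values lo 0 and up 0 play no role. *)
definition tridiag_mat ::
    "nat \<Rightarrow> (nat \<Rightarrow> 'f::zero) \<Rightarrow> (nat \<Rightarrow> 'f) \<Rightarrow> (nat \<Rightarrow> 'f) \<Rightarrow> 'f mat" where
  "tridiag_mat d lo di up = mat (d + 1) (d + 1)
     (\<lambda>(i, j). if i = j + 1 then lo i else if i = j then di i else if j = i + 1 then up j else 0)"

definition lower_bidiag_mat :: "nat \<Rightarrow> (nat \<Rightarrow> 'f::zero) \<Rightarrow> (nat \<Rightarrow> 'f) \<Rightarrow> 'f mat" where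
  "lower_bidiag_mat d lo di = tridiag_mat d lo di (\<lambda>_. 0)"

definition upper_bidiag_mat :: "nat \<Rightarrow> (nat \<Rightarrow> 'f::zero) \<Rightarrow> (nat \<Rightarrow> 'f) \<Rightarrow> 'f mat" where
  "upper_bidiag_mat d di up = tridiag_mat d (\<lambda>_. 0) di up"

definition irreducible_tridiagonal :: "'f::zero mat \<Rightarrow> bool" where
  "irreducible_tridiagonal M \<longleftrightarrow>
     (\<forall>i < dim_row M. \<forall>j < dim_col M.
        (i > j + 1 \<or> j > i + 1 \<longrightarrow> M $$ (i, j) = 0) \<and>
        (i = j + 1 \<or> j = i + 1 \<longrightarrow> M $$ (i, j) \<noteq> 0))"

definition feasible :: "'f::field \<Rightarrow> 'f \<Rightarrow> 'f \<Rightarrow> 'f \<Rightarrow> nat \<Rightarrow> bool" where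
  "feasible q a b c d \<longleftrightarrow>
     a \<noteq> 0 \<and> b \<noteq> 0 \<and> c \<noteq> 0 \<and> d \<ge> 1 \<and>
     {a ^ 2, b ^ 2} \<inter> {q powi (2 * int d - 2 * k) | k. k \<in> {1..2 * int d - 1}} = {} \<and>
     {a * b * c, inverse a * b * c, a * inverse b * c, a * b * inverse c} \<inter>
       {q powi (int d + 1 - 2 * k) | k. k \<in> {1..int d}} = {}"

definition theta :: "'f::field \<Rightarrow> 'f \<Rightarrow> nat \<Rightarrow> nat \<Rightarrow> 'f" where
  "theta q a d n = a * q powi (2 * int n - int d) + inverse a * q powi (int d - 2 * int n)"

definition varphi :: "'f::field \<Rightarrow> 'f \<Rightarrow> 'f \<Rightarrow> 'f \<Rightarrow> nat \<Rightarrow> nat \<Rightarrow> 'f" where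
  "varphi q a b c d n =
     inverse a * inverse b * q ^ (d + 1) * (q powi int n - q powi (- int n)) *
     (q powi (int n - int d - 1) - q powi (int d - int n + 1)) *
     (q powi (- int n) - a * b * c * q powi (int n - int d - 1)) *
     (q powi (- int n) - a * b * inverse c * q powi (int n - int d - 1))"

definition phi :: "'f::field \<Rightarrow> 'f \<Rightarrow> 'f \<Rightarrow> 'f \<Rightarrow> nat \<Rightarrow> nat \<Rightarrow> 'f" where
  "phi q a b c d n =
     a * inverse b * q ^ (d + 1) * (q powi int n - q powi (- int n)) *
     (q powi (int n - int d - 1) - q powi (int d - int n + 1)) *
     (q powi (- int n) - inverse a * b * c * q powi (int n - int d - 1)) *
     (q powi (- int n) - inverse a * b * inverse c * q powi (int n - int d - 1))"

(* V is the whole type 'v, made into a vector space over 'f by the scalar multiplication scale. *)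

definition basis_seq ::
    "('f::field \<Rightarrow> 'v::ab_group_add \<Rightarrow> 'v) \<Rightarrow> nat \<Rightarrow> (nat \<Rightarrow> 'v) \<Rightarrow> bool" where
  "basis_seq scale d v \<longleftrightarrow>
     inj_on v {0..d} \<and> \<not> module.dependent scale (v ` {0..d}) \<and>
     module.span scale (v ` {0..d}) = UNIV"

definition represents ::
    "('f::field \<Rightarrow> 'v::ab_group_add \<Rightarrow> 'v) \<Rightarrow> nat \<Rightarrow> (nat \<Rightarrow> 'v) \<Rightarrow> 'f mat \<Rightarrow> ('v \<Rightarrow> 'v) \<Rightarrow> bool" where
  "represents scale d v M A \<longleftrightarrow> M \<in> carrier_mat (d + 1) (d + 1) \<and>
     (\<forall>n \<le> d. A (v n) = (\<Sum>i = 0..d. scale (M $$ (i, n)) (v i)))"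

(* A basis indexed by 0, ..., d exists exactly if the space is finite-dimensional and nonzero. *)
definition leonard_pair ::
    "('f::field \<Rightarrow> 'v::ab_group_add \<Rightarrow> 'v) \<Rightarrow> ('v \<Rightarrow> 'v) \<Rightarrow> ('v \<Rightarrow> 'v) \<Rightarrow> bool" where
  "leonard_pair scale A B \<longleftrightarrow>
     Vector_Spaces.linear scale scale A \<and> Vector_Spaces.linear scale scale B \<and>
     (\<exists>d v M N. basis_seq scale d v \<and> represents scale d v M A \<and> represents scale d v N B \<and>
        diagonal_mat M \<and> irreducible_tridiagonal N) \<and>
     (\<exists>d v M N. basis_seq scale d v \<and> represents scale d v M A \<and> represents scale d v N B \<and>
        irreducible_tridiagonal M \<and> diagonal_mat N)"

(* The two split forms are invariant under isomorphism of Leonard pairs, so that this predicate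
   covers the whole isomorphism class attached to the feasible sequence. *)
definition corresponds ::
    "('f::field \<Rightarrow> 'v::ab_group_add \<Rightarrow> 'v) \<Rightarrow> 'f \<Rightarrow> ('v \<Rightarrow> 'v) \<Rightarrow> ('v \<Rightarrow> 'v) \<Rightarrow> 'f \<Rightarrow> 'f \<Rightarrow> 'f \<Rightarrow> nat \<Rightarrow> bool" where
  "corresponds scale q A B a b c d \<longleftrightarrow>
     leonard_pair scale A B \<and> feasible q a b c d \<and>
     (\<exists>v. basis_seq scale d v \<and>
        represents scale d v (lower_bidiag_mat d (\<lambda>_. 1) (theta q a d)) A \<and>
        represents scale d v (upper_bidiag_mat d (theta q b d) (varphi q a b c d)) B) \<and>
     (\<exists>v. basis_seq scale d v \<and>
        represents scale d v (lower_bidiag_mat d (\<lambda>_. 1) (\<lambda>n. theta q a d (d - n))) A \<and>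
        represents scale d v (upper_bidiag_mat d (theta q b d) (phi q a b c d)) B)"

definition q_racah_type ::
    "('f::field \<Rightarrow> 'v::ab_group_add \<Rightarrow> 'v) \<Rightarrow> 'f \<Rightarrow> ('v \<Rightarrow> 'v) \<Rightarrow> ('v \<Rightarrow> 'v) \<Rightarrow> bool" where
  "q_racah_type scale q A B \<longleftrightarrow> (\<exists>a b c d. corresponds scale q A B a b c d)"

end

theory Submission
  imports Defs
begin

text \<open>
  The tridiagonal form is what one sees when \<open>A\<close> and \<open>B\<close> act on polynomials of degree at most \<open>d\<close>
  and the basis consists of rescaled monomials. After rescaling, the two matrices of the statement
  become the second-order \<open>q\<close>-difference operators
    \<open>B f(x) = ((1 + x^2) f(x) - (1 - b q^-d x)(1 - b^-1 q^-d x) f(q^2 x)) / x\<close> and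
    \<open>A f(x) = ((1 + y^2) f(x) - (1 - a q^d y)(1 - a^-1 q^d y) f(q^-2 x)) / y\<close>
  with \<open>y = \<kappa> x\<close> and \<open>\<kappa> = c^-1 q^-(d+1)\<close>. Both belong to one family \<open>qdiff_op\<close>: the second arises
  from the first by replacing \<open>q\<close> with \<open>q^-1\<close>, \<open>b\<close> with \<open>a\<close>, and \<open>x\<close> with \<open>y\<close>.

  In this model the split basis is explicit. Put
    \<open>h\<^sub>n = \<Prod>\<^bsub>i<n\<^esub> (1 - a^-1 q^(d-2i) y) \<cdot> \<Prod>\<^bsub>j<d-n\<^esub> (1 - b^-1 q^(2j-d) x)\<close>.
  A dilation \<open>x \<mapsto> q^2 x\<close> or \<open>x \<mapsto> q^-2 x\<close> changes only the end factors of each product, so \<open>A h\<^sub>n\<close> is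
  \<open>\<theta>\<^sub>n h\<^sub>n\<close> plus a multiple \<open>K\<^sub>n h\<^sub>n\<^sub>+\<^sub>1\<close>, and \<open>B h\<^sub>n\<close> is \<open>\<theta>\<^sup>*\<^sub>n h\<^sub>n\<close> plus a multiple of \<open>h\<^sub>n\<^sub>-\<^sub>1\<close>
  (\<open>qdiff_op_prod\<close>). The product of the two multipliers is the entry \<open>varphi\<^sub>n\<close> of the first split form
  (\<open>varphi_factorization\<close>), so that the vectors \<open>u\<^sub>n = K\<^sub>0 \<cdots> K\<^sub>n\<^sub>-\<^sub>1 h\<^sub>n\<close> satisfy exactly the relations
  imposed on the split basis of the Leonard pair.

  Since \<open>q\<close> is not a root of unity, the rescaling of the monomials is invertible. The condition on
  \<open>abc\<close> and its variants in the definition of feasibility enters twice: it makes all \<open>K\<^sub>n\<close> with \<open>n < d\<close>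
  nonzero, and it keeps the zeros of the two kinds of factors apart, which makes the \<open>h\<^sub>n\<close> linearly independent (\<open>mixed_products_independent\<close>). Hence
  sending \<open>u\<^sub>n\<close> to the given split basis defines an isomorphism between the model and the Leonard pair,
  and the images of the rescaled monomials form the required basis (\<open>transport_basis\<close>).
\<close>

\<comment> \<open>Leaves the unqualified name to the scalar multiplication of polynomials.\<close>
hide_const (open) Module.smult

section \<open>Transporting a basis from a model\<close>

text \<open>
  A vector of \<open>T\<close> outside the span of \<open>S\<close> would enlarge \<open>S\<close> to an independent set with more elements
  than the spanning set \<open>T\<close>.
\<close>

lemma exchange_span:
  assumes "vector_space scale" "finite T" "card T \<le> card S" "S \<subseteq> module.span scale T"
    and "\<not> module.dependent scale S"
  shows "T \<subseteq> module.span scale S"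
proof -
  interpret vector_space scale by fact
  obtain t where t: "card t = card T" "finite t" "S \<subseteq> t"
    using exchange_lemma[OF assms(2,5,4)] by blast
  then have "S = t"
    using assms(3) card_mono[OF t(2,3)] by (intro card_subset_eq) auto
  then have card: "card S = card T" "finite S" using t by auto
  show ?thesis
  proof
    fix x assume x: "x \<in> T"
    show "x \<in> span S"
    proof (rule ccontr)
      assume "x \<notin> span S"
      then have "independent (insert x S)" "x \<notin> S"
        using assms(5) independent_insert[of x S] span_base by auto
      moreover have "insert x S \<subseteq> span T"
        using x assms(4) span_base by auto
      ultimately show False
        using independent_span_bound[of T "insert x S"] assms(2) card by simp
    qed
  qed
qed

text \<open>
  A maximal independent subfamily still spans, so it needs at least \<open>d + 1\<close> members; hence nothing was
  discarded and no vector was repeated.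
\<close>

lemma basis_seq_if_spanning:
  assumes "vector_space scale" "basis_seq scale d v"
    and span: "module.span scale (w ` {0..d}) = UNIV"
  shows "basis_seq scale d w"
proof -
  interpret vector_space scale by fact
  have v: "independent (v ` {0..d})" "card (v ` {0..d}) = d + 1"
    using assms(2) by (auto simp: basis_seq_def card_image)
  obtain W where W: "W \<subseteq> w ` {0..d}" "independent W" "w ` {0..d} \<subseteq> span W"
    by (rule maximal_independent_subset)
  have "span W = UNIV"
    using span span_mono[OF W(3)] by (auto simp: span_span)
  moreover have "finite W" using W(1) by (rule finite_subset) simp
  ultimately have "d + 1 \<le> card W"
    using independent_span_bound[of W "v ` {0..d}"] v by auto
  moreover have "card W \<le> card (w ` {0..d})" using W(1) by (intro card_mono) auto
  moreover have "card (w ` {0..d}) \<le> d + 1" using card_image_le[of "{0..d}" w] by simp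
  ultimately have card: "card (w ` {0..d}) = d + 1" "card W = card (w ` {0..d})"
    by auto
  then have "W = w ` {0..d}"
    using W(1) by (intro card_subset_eq) auto
  then show ?thesis
    using W(2) span card(1) by (auto simp: basis_seq_def intro!: eq_card_imp_inj_on)
qed

text \<open>
  Here \<open>u\<close> plays the part of \<open>v\<close> inside a model: an operator of the model that has the same matrix on
  \<open>u\<close> as \<open>A\<close> has on \<open>v\<close> corresponds to \<open>A\<close> under the linear map with \<open>u\<^sub>n \<mapsto> v\<^sub>n\<close>. The model is
  the span of \<open>u\<close>, which may be a small part of the ambient space. The basis \<open>w\<close> is the image of \<open>e\<close>
  and is chosen before the operators, so that it serves several operators at once.
\<close>

lemma transport_basis:
  fixes scale :: "'f::field \<Rightarrow> 'v::ab_group_add \<Rightarrow> 'v"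
    and scale' :: "'f \<Rightarrow> 'p::ab_group_add \<Rightarrow> 'p"
  assumes "vector_space scale" "vector_space scale'" "basis_seq scale d v"
    and u: "inj_on u {0..d}" "\<not> module.dependent scale' (u ` {0..d})"
    and ue: "\<And>n. n \<le> d \<Longrightarrow> u n \<in> module.span scale' (e ` {0..d})"
  obtains w where "basis_seq scale d w"
    and "\<And>A D M N. Vector_Spaces.linear scale scale A \<Longrightarrow> Vector_Spaces.linear scale' scale' D \<Longrightarrow>
      represents scale d v M A \<Longrightarrow> represents scale' d u M D \<Longrightarrow> represents scale' d e N D \<Longrightarrow>
      represents scale d w N A"
proof -
  interpret V: vector_space scale by fact
  interpret P: vector_space scale' by fact
  interpret PV: vector_space_pair scale' scale by unfold_locales
  define g where "g = v \<circ> the_inv_into {0..d} u"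
  obtain \<Psi> where \<Psi>: "Vector_Spaces.linear scale' scale \<Psi>" "\<forall>x\<in>u ` {0..d}. \<Psi> x = g x"
    using PV.linear_independent_extend[OF u(2)] by blast
  interpret \<Psi>: Vector_Spaces.linear scale' scale \<Psi> by (rule \<Psi>(1))
  have \<Psi>u: "\<Psi> (u n) = v n" if "n \<le> d" for n
    using that \<Psi>(2) u(1) by (simp add: g_def the_inv_into_f_f)
  define w where "w n = \<Psi> (e n)" for n
  have eu: "e ` {0..d} \<subseteq> P.span (u ` {0..d})"
  proof (rule exchange_span[OF assms(2) _ _ _ u(2)])
    show "card (e ` {0..d}) \<le> card (u ` {0..d})"
      unfolding card_image[OF u(1)] by (rule card_image_le) simp
    show "u ` {0..d} \<subseteq> P.span (e ` {0..d})" using ue by auto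
  qed simp
  have "v n \<in> V.span (w ` {0..d})" if "n \<le> d" for n
  proof -
    have "\<Psi> (u n) \<in> \<Psi> ` P.span (e ` {0..d})" using ue[OF that] by blast
    also have "\<dots> = V.span (w ` {0..d})"
      by (simp only: \<Psi>.span_image[of "e ` {0..d}", symmetric] image_image w_def[abs_def])
    finally show ?thesis using \<Psi>u that by simp
  qed
  then have "V.span (v ` {0..d}) \<subseteq> V.span (w ` {0..d})"
    by (intro V.span_minimal) auto
  then have "basis_seq scale d w"
    using assms(3) by (intro basis_seq_if_spanning[OF assms(1,3)]) (simp add: basis_seq_def top_unique)
  moreover have "represents scale d w N A"
    if A: "Vector_Spaces.linear scale scale A" and D: "Vector_Spaces.linear scale' scale' D"
      and r: "represents scale d v M A" "represents scale' d u M D" "represents scale' d e N D"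
    for A D M N
  proof -
    have lin: "Vector_Spaces.linear scale' scale (A \<circ> \<Psi>)" "Vector_Spaces.linear scale' scale (\<Psi> \<circ> D)"
      using Vector_Spaces.linear_compose[OF \<Psi>(1) A] Vector_Spaces.linear_compose[OF D \<Psi>(1)] by auto
    have "(A \<circ> \<Psi>) (u n) = (\<Psi> \<circ> D) (u n)" if "n \<le> d" for n
      using r(1,2) that by (simp add: represents_def \<Psi>u \<Psi>.sum \<Psi>.scale)
    then have "(A \<circ> \<Psi>) x = (\<Psi> \<circ> D) x" if "x \<in> P.span (u ` {0..d})" for x
      by (intro PV.linear_eq_on[OF lin that]) auto
    then have "A (w n) = \<Psi> (D (e n))" if "n \<le> d" for n
      using eu that by (simp add: w_def image_subset_iff)
    then show ?thesis
      using r(3) by (simp add: represents_def \<Psi>.sum \<Psi>.scale w_def)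
  qed
  ultimately show ?thesis by (rule that)
qed

text \<open>
  Column \<open>n\<close> of a tridiagonal matrix contributes at most three terms; the two bidiagonal forms are the
  special cases in which one of the outer terms is zero.
\<close>

lemma represents_tridiag_mat_iff:
  assumes "vector_space scale"
  shows "represents scale d v (tridiag_mat d lo di up) A \<longleftrightarrow> (\<forall>n\<le>d. A (v n) =
    (if n = 0 then 0 else scale (up n) (v (n - 1))) + scale (di n) (v n) +
    (if n < d then scale (lo (n + 1)) (v (n + 1)) else 0))"
proof -
  interpret vector_space scale by fact
  have "(\<Sum>i = 0..d. scale (tridiag_mat d lo di up $$ (i, n)) (v i)) =
      (if n = 0 then 0 else scale (up n) (v (n - 1))) + scale (di n) (v n) +
      (if n < d then scale (lo (n + 1)) (v (n + 1)) else 0)" if "n \<le> d" for n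
  proof -
    have "(\<Sum>i = 0..d. scale (tridiag_mat d lo di up $$ (i, n)) (v i)) =
      (\<Sum>i = 0..d. (if i = n - 1 then if n = 0 then 0 else scale (up n) (v (n - 1)) else 0) +
        (if i = n then scale (di n) (v n) else 0) +
        (if i = n + 1 then scale (lo (n + 1)) (v (n + 1)) else 0))"
      using that by (intro sum.cong refl) (auto simp: tridiag_mat_def)
    then show ?thesis
      using that by (auto simp: sum.distrib)
  qed
  moreover have "tridiag_mat d lo di up \<in> carrier_mat (d + 1) (d + 1)"
    by (simp add: tridiag_mat_def)
  ultimately show ?thesis
    by (simp add: represents_def)
qed

lemma independent_family:
  fixes u :: "nat \<Rightarrow> 'v::ab_group_add"
  assumes "vector_space scale"
    and "\<And>l n. (\<Sum>n = 0..d. scale (l n) (u n)) = 0 \<Longrightarrow> n \<le> d \<Longrightarrow> l n = 0"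
  shows "inj_on u {0..d}" "\<not> module.dependent scale (u ` {0..d})"
proof -
  interpret vector_space scale by fact
  show inj: "inj_on u {0..d}"
  proof (rule inj_onI, rule ccontr)
    fix i j assume ij: "i \<in> {0..d}" "j \<in> {0..d}" "u i = u j" "i \<noteq> j"
    define l where "l n = (if n = i then 1 else 0) - (if n = j then 1 else (0 :: 'a))" for n
    have "(\<Sum>n = 0..d. scale (l n) (u n)) =
        (\<Sum>n = 0..d. (if n = i then u i else 0) - (if n = j then u j else 0))"
      by (intro sum.cong) (auto simp: l_def)
    also have "\<dots> = 0"
      unfolding sum_subtractf using ij(1,2) by (simp add: ij(3))
    finally show False using assms(2)[of l i] ij by (simp add: l_def)
  qed
  show "independent (u ` {0..d})"
  proof (rule independent_if_scalars_zero)
    fix f x assume "(\<Sum>x\<in>u ` {0..d}. scale (f x) x) = 0" "x \<in> u ` {0..d}"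
    then show "f x = 0"
      using assms(2)[of "\<lambda>n. f (u n)"] inj by (auto simp: sum.reindex)
  qed simp
qed

section \<open>Two families of linear factors\<close>

text \<open>
  Evaluation at the root of \<open>s 0\<close> kills every product except the last, which contains no factor of the
  second family and is nonzero there; so its coefficient vanishes. All other products are divisible by
  \<open>s 0\<close>, and cancelling it leaves the same situation with \<open>d - 1\<close> and the second family shifted by one.
  Every step meets only the pairs of factors with \<open>i + j < d\<close>.
\<close>

lemma mixed_products_independent:
  fixes p s :: "nat \<Rightarrow> 'f::field poly"
  assumes "\<And>j. j < d \<Longrightarrow> s j \<noteq> 0" "\<And>j. j < d \<Longrightarrow> poly (s j) (r j) = 0"
    and "\<And>i j. i + j < d \<Longrightarrow> poly (p i) (r j) \<noteq> 0"
    and "(\<Sum>n = 0..d. smult (l n) ((\<Prod>i<n. p i) * (\<Prod>j<d - n. s j))) = 0" "n \<le> d"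
  shows "l n = 0"
  using assms
proof (induction d arbitrary: s r n)
  case 0
  then show ?case by simp
next
  case (Suc d)
  define t where "t n = smult (l n) ((\<Prod>i<n. p i) * (\<Prod>j<d - n. s (Suc j)))" for n
  have t: "smult (l n) ((\<Prod>i<n. p i) * (\<Prod>j<Suc d - n. s j)) = s 0 * t n" if "n \<le> d" for n
    using that
    by (simp add: t_def Suc_diff_le prod.lessThan_Suc_shift mult.left_commute del: prod.lessThan_Suc)
  have "(\<Sum>n = 0..Suc d. smult (l n) ((\<Prod>i<n. p i) * (\<Prod>j<Suc d - n. s j)))
      = s 0 * (\<Sum>n = 0..d. t n) + smult (l (Suc d)) (\<Prod>i<Suc d. p i)"
    by (simp add: t sum_distrib_left del: prod.lessThan_Suc)
  then have *: "s 0 * (\<Sum>n = 0..d. t n) + smult (l (Suc d)) (\<Prod>i<Suc d. p i) = 0"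
    using Suc.prems(4) by simp
  then have "poly (s 0 * (\<Sum>n = 0..d. t n) + smult (l (Suc d)) (\<Prod>i<Suc d. p i)) (r 0) = 0"
    by simp
  then have "l (Suc d) * (\<Prod>i<Suc d. poly (p i) (r 0)) = 0"
    using Suc.prems(2)[of 0] by (simp add: poly_prod del: prod.lessThan_Suc)
  moreover have "(\<Prod>i<Suc d. poly (p i) (r 0)) \<noteq> 0"
    using Suc.prems(3)[of _ 0] by (subst prod_zero_iff) auto
  ultimately have l: "l (Suc d) = 0" by simp
  then have "(\<Sum>n = 0..d. t n) = 0" using * Suc.prems(1)[of 0] by simp
  then have "l n = 0" if "n \<le> d" for n
    using Suc.prems that
    by (intro Suc.IH[of "\<lambda>j. s (Suc j)" "\<lambda>j. r (Suc j)" n]) (auto simp: t_def)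
  then show ?case using l Suc.prems(5) by (cases "n = Suc d") auto
qed

section \<open>A second-order q-difference operator\<close>

text \<open>
  The shift \<open>poly_shift 1\<close> is the division by \<open>x\<close>; it is exact, because the constant coefficient of
  its argument cancels. For a monomial \<open>f\<close> that argument is \<open>f\<close> times a quadratic polynomial, so after
  the division only the neighbouring degrees occur.
\<close>

definition qdiff_op :: "'f::field \<Rightarrow> 'f \<Rightarrow> 'f \<Rightarrow> nat \<Rightarrow> 'f poly \<Rightarrow> 'f poly" where
  "qdiff_op \<kappa> b Q d f = smult (inverse \<kappa>) (poly_shift 1
     ([:1, 0, \<kappa>\<^sup>2:] * f
      - [:1, - (\<kappa> * b / Q ^ d):] * [:1, - (\<kappa> / (b * Q ^ d)):] * pcompose f [:0, Q\<^sup>2:]))"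

text \<open>
  The exponents advance in steps of two, so that replacing \<open>x\<close> with \<open>Q\<^sup>2 x\<close> turns the factor \<open>j\<close> into
  the factor \<open>j + 1\<close>.
\<close>

definition qfactor :: "'f::field \<Rightarrow> 'f \<Rightarrow> nat \<Rightarrow> nat \<Rightarrow> 'f poly" where
  "qfactor \<beta> Q d j = [:1, - (\<beta> * Q ^ (2 * j) / Q ^ d):]"

lemma poly_shift_add: "poly_shift n (f + g) = poly_shift n f + poly_shift n g"
  by (simp add: poly_eq_iff coeff_poly_shift)

lemma poly_shift_smult: "poly_shift n (smult c f) = smult c (poly_shift n f)"
  for f :: "'a::comm_semiring_0 poly"
  by (simp add: poly_eq_iff coeff_poly_shift)

lemma vector_space_poly: "vector_space (smult :: 'f::field \<Rightarrow> 'f poly \<Rightarrow> 'f poly)"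
  by unfold_locales (auto simp: smult_add_right smult_add_left)

lemma linear_qdiff_op: "Vector_Spaces.linear smult smult (qdiff_op \<kappa> b Q d)"
proof -
  define p r where "p = [:1, 0, \<kappa>\<^sup>2:]"
    and "r = [:1, - (\<kappa> * b / Q ^ d):] * [:1, - (\<kappa> / (b * Q ^ d)):]"
  have op: "qdiff_op \<kappa> b Q d f = smult (inverse \<kappa>) (poly_shift 1 (p * f - r * pcompose f [:0, Q\<^sup>2:]))" for f
    by (simp only: qdiff_op_def p_def r_def)
  have "p * (f + g) - r * (f' + g') = (p * f - r * f') + (p * g - r * g')" for f g f' g'
    by (simp add: algebra_simps)
  moreover have "p * smult c f - r * smult c f' = smult c (p * f - r * f')" for c f f'
    by (simp add: smult_diff_right)
  ultimately show ?thesis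
    unfolding Vector_Spaces.linear_iff op
    by (simp only: vector_space_poly pcompose_add pcompose_smult poly_shift_add
      poly_shift_smult smult_add_right smult_smult) (simp add: ac_simps)
qed

text \<open>
  This form avoids division: a value of the operator is recognised after multiplication by \<open>\<kappa> x\<close>.
\<close>

lemma qdiff_op_eqI:
  assumes "\<kappa> \<noteq> 0"
    and "[:1, 0, \<kappa>\<^sup>2:] * f - [:1, - (\<kappa> * b / Q ^ d):] * [:1, - (\<kappa> / (b * Q ^ d)):] *
        pcompose f [:0, Q\<^sup>2:] = [:0, \<kappa>:] * g"
  shows "qdiff_op \<kappa> b Q d f = g"
proof -
  have "poly_shift 1 ([:0, \<kappa>:] * g) = smult \<kappa> g"
    by (simp add: poly_eq_iff coeff_poly_shift)
  then show ?thesis using assms by (simp add: qdiff_op_def)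
qed

text \<open>
  The outer coefficients vanish for \<open>n = 0\<close> and for \<open>n = d\<close>, respectively. Thus the truncated predecessor
  \<open>n - 1\<close> is harmless and the polynomials of degree at most \<open>d\<close> form an invariant subspace.
\<close>

lemma qdiff_op_monom:
  assumes "\<kappa> \<noteq> 0" "b \<noteq> 0" "Q \<noteq> 0"
  shows "qdiff_op \<kappa> b Q d (monom 1 n) =
    monom ((1 - Q ^ (2 * n)) / \<kappa>) (n - 1) + monom ((b + inverse b) * Q ^ (2 * n) / Q ^ d) n
      + monom (\<kappa> * (1 - Q ^ (2 * n) / Q ^ (2 * d))) (n + 1)"
proof (rule qdiff_op_eqI[OF assms(1)])
  have comp: "pcompose (monom 1 n) [:0, Q\<^sup>2:] = monom (Q ^ (2 * n)) n" for n
  proof (induction n)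
    case (Suc n)
    then show ?case by (simp add: monom_Suc pcompose_pCons smult_monom power2_eq_square ac_simps)
  qed (simp add: monom_0 pcompose_1)
  define r s M where "r = \<kappa> * b / Q ^ d" and "s = \<kappa> / (b * Q ^ d)" and "M = Q ^ (2 * n)"
  have quad: "[:x, y, z:] = monom x 0 + monom y 1 + monom z 2" for x y z :: 'a
    by (simp add: monom_Suc monom_0 numeral_2_eq_2)
  have "[:1, 0, \<kappa>\<^sup>2:] * monom 1 n - [:1, - r:] * [:1, - s:] * monom M n =
      [:1 - M, (r + s) * M, \<kappa>\<^sup>2 - r * s * M:] * monom 1 n"
  proof -
    have "[:1, 0, \<kappa>\<^sup>2:] - smult M ([:1, - r:] * [:1, - s:]) =
        [:1 - M, (r + s) * M, \<kappa>\<^sup>2 - r * s * M:]"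
      by (simp add: algebra_simps)
    moreover have "monom M n = smult M (monom 1 n)" by (simp add: smult_monom)
    ultimately show ?thesis
      by (simp only: left_diff_distrib mult_smult_left mult_smult_right flip: \<open>_ = [:1 - M, _, _:]\<close>)
  qed
  also have "\<dots> = monom (1 - M) n + monom ((r + s) * M) (n + 1) + monom (\<kappa>\<^sup>2 - r * s * M) (n + 2)"
    unfolding quad distrib_right mult_monom by simp
  also have "(r + s) * M = \<kappa> * ((b + inverse b) * M / Q ^ d)"
    using assms by (simp add: r_def s_def field_simps)
  also have "\<kappa>\<^sup>2 - r * s * M = \<kappa> * (\<kappa> * (1 - M / Q ^ (2 * d)))"
    using assms by (simp add: r_def s_def field_simps power2_eq_square flip: power_add mult_2)
  also have "monom (1 - M) n = monom \<kappa> 1 * monom ((1 - M) / \<kappa>) (n - 1)"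
    using assms by (cases n) (simp_all add: mult_monom M_def)
  also have "monom \<kappa> 1 = [:0, \<kappa>:]" by (simp add: monom_Suc monom_0)
  also have "monom (\<kappa> * x) (k + 1) = [:0, \<kappa>:] * monom x k" for x k
    by (simp add: monom_Suc smult_monom)
  also have "monom (\<kappa> * x) (n + 2) = [:0, \<kappa>:] * monom x (n + 1)" for x
    by (simp add: monom_Suc smult_monom)
  finally show "[:1, 0, \<kappa>\<^sup>2:] * monom 1 n - [:1, - (\<kappa> * b / Q ^ d):] * [:1, - (\<kappa> / (b * Q ^ d)):] *
      pcompose (monom 1 n) [:0, Q\<^sup>2:] = [:0, \<kappa>:] *
      (monom ((1 - Q ^ (2 * n)) / \<kappa>) (n - 1) + monom ((b + inverse b) * Q ^ (2 * n) / Q ^ d) n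
      + monom (\<kappa> * (1 - Q ^ (2 * n) / Q ^ (2 * d))) (n + 1))"
    unfolding comp r_def s_def M_def distrib_left .
qed

text \<open>
  The dilation by \<open>Q\<^sup>2\<close> advances the \<open>m\<close> factors of the first product by one place and moves the \<open>k\<close>
  factors of the second, which are built with \<open>inverse Q\<close>, back by one place. The missing first factor
  of the advanced product is supplied by the coefficient in the operator. Hence the first product and
  all but the last factor of the second can be taken out of every term, which leaves
  an identity between cubic polynomials with the parameters \<open>r\<close>, \<open>s\<close>, \<open>\<sigma>\<close> and \<open>M\<close>. The second
  multiplier vanishes for \<open>k = 0\<close>, so that the truncated \<open>k - 1\<close> does no harm.
\<close>

lemma qdiff_op_prod:
  fixes \<rho> :: "'f::field"
  assumes nz: "\<kappa> \<noteq> 0" "b \<noteq> 0" "Q \<noteq> 0" and d: "m + k = d"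
  defines "t \<equiv> b * Q ^ d / Q ^ (2 * m)"
  shows "qdiff_op \<kappa> b Q d ((\<Prod>j<m. qfactor (\<kappa> / b) Q d j) * (\<Prod>j<k. qfactor \<rho> (inverse Q) d j)) =
    smult (t + inverse t) ((\<Prod>j<m. qfactor (\<kappa> / b) Q d j) * (\<Prod>j<k. qfactor \<rho> (inverse Q) d j)) +
    smult ((1 - Q ^ (2 * k)) * (b / Q ^ d - \<rho> / \<kappa> * (Q ^ (d + 2) / Q ^ (2 * k))))
      ((\<Prod>j<Suc m. qfactor (\<kappa> / b) Q d j) * (\<Prod>j<k - 1. qfactor \<rho> (inverse Q) d j))"
proof (rule qdiff_op_eqI[OF nz(1)])
  define F where "F m = (\<Prod>j<m. qfactor (\<kappa> / b) Q d j)" for m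
  define G where "G k = (\<Prod>j<k. qfactor \<rho> (inverse Q) d j)" for k
  have F: "[:1, - (\<kappa> / (b * Q ^ d)):] * pcompose (F m) [:0, Q\<^sup>2:] = F m * qfactor (\<kappa> / b) Q d m" for m
  proof (induction m)
    case 0
    show ?case by (simp add: F_def qfactor_def pcompose_1)
  next
    case (Suc m)
    have "[:1, - (\<kappa> / (b * Q ^ d)):] * pcompose (F (Suc m)) [:0, Q\<^sup>2:] =
        F m * qfactor (\<kappa> / b) Q d m * pcompose (qfactor (\<kappa> / b) Q d m) [:0, Q\<^sup>2:]"
      using Suc by (simp add: F_def pcompose_mult mult.assoc[symmetric] del: mult_pCons_left)
    also have "pcompose (qfactor (\<kappa> / b) Q d m) [:0, Q\<^sup>2:] = qfactor (\<kappa> / b) Q d (Suc m)"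
      by (simp add: qfactor_def pcompose_pCons power2_eq_square ac_simps)
    finally show ?case by (simp add: F_def)
  qed
  have G: "pcompose (G (Suc k)) [:0, Q\<^sup>2:] = [:1, - (\<rho> * Q ^ (d + 2)):] * G k" for k
  proof (induction k)
    case 0
    show ?case
      using nz by (simp add: G_def qfactor_def pcompose_pCons power_inverse divide_inverse power2_eq_square)
  next
    case (Suc k)
    have "pcompose (qfactor \<rho> (inverse Q) d (Suc k)) [:0, Q\<^sup>2:] = qfactor \<rho> (inverse Q) d k"
      using nz by (simp add: qfactor_def pcompose_pCons power2_eq_square field_simps power_inverse)
    then show ?case using Suc
      by (simp add: G_def pcompose_mult mult.assoc del: mult_pCons_left)
  qed
  show "[:1, 0, \<kappa>\<^sup>2:] * (F m * G k) - [:1, - (\<kappa> * b / Q ^ d):] * [:1, - (\<kappa> / (b * Q ^ d)):] *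
      pcompose (F m * G k) [:0, Q\<^sup>2:] = [:0, \<kappa>:] * (smult (t + inverse t) (F m * G k) +
    smult ((1 - Q ^ (2 * k)) * (b / Q ^ d - \<rho> / \<kappa> * (Q ^ (d + 2) / Q ^ (2 * k))))
      (F (Suc m) * G (k - 1)))"
  proof (cases k)
    case 0
    define r s where "r = \<kappa> * b / Q ^ d" and "s = \<kappa> / b * Q ^ (2 * m) / Q ^ d"
    have G0: "G 0 = 1" and q: "qfactor (\<kappa> / b) Q d m = [:1, - s:]"
      using 0 by (simp_all add: G_def qfactor_def s_def)
    have M: "\<kappa>\<^sup>2 = r * s" "\<kappa> * (t + inverse t) = r + s"
      using nz d 0 by (simp_all add: r_def s_def t_def field_simps power2_eq_square flip: power_add mult_2)
    have "[:1, 0, \<kappa>\<^sup>2:] * F m - [:1, - r:] * ([:1, - (\<kappa> / (b * Q ^ d)):] * pcompose (F m) [:0, Q\<^sup>2:])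
        = ([:1, 0, r * s:] - [:1, - r:] * [:1, - s:]) * F m"
      unfolding F M(1) q by (simp only: left_diff_distrib right_diff_distrib ac_simps)
    also have "[:1, 0, r * s:] - [:1, - r:] * [:1, - s:] = [:0, \<kappa> * (t + inverse t):]"
      unfolding M(2) by simp
    also have "[:0, \<kappa> * (t + inverse t):] * F m = [:0, \<kappa>:] * smult (t + inverse t) (F m)"
      by (simp add: mult.commute[of \<kappa>])
    finally show ?thesis
      unfolding 0 G0 r_def
      by (simp only: mult_1_right mult_0_right power_0 diff_self mult_zero_left smult_0_left
          add_0_right mult.assoc)
  next
    case (Suc k')
    define r s \<sigma> M where "r = \<kappa> * b / Q ^ d" and "s = \<kappa> / b * Q ^ (2 * m) / Q ^ d"
      and "\<sigma> = \<rho> * Q ^ d / Q ^ (2 * k')" and "M = Q ^ (2 * k)"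
    define P K where "P = Q ^ m" and "K = Q ^ k'"
    have PK: "Q ^ d = P * (K * Q)" "Q ^ (2 * m) = P * P" "Q ^ (2 * k') = K * K"
      "Q ^ (2 * k) = (K * K) * (Q * Q)" "Q ^ (d + 2) = P * (K * Q) * (Q * Q)" "P \<noteq> 0" "K \<noteq> 0"
      using nz by (simp_all add: P_def K_def d[symmetric] Suc power_add mult_2)
    note e = r_def s_def \<sigma>_def M_def t_def PK(1-5)
    have M1: "\<kappa>\<^sup>2 = r * s * M" "\<rho> * Q ^ (d + 2) = \<sigma> * M"
      using nz PK(6,7) unfolding e by (simp_all add: field_simps power2_eq_square)
    have "\<kappa> * t = r * M" "\<kappa> * inverse t = s"
      using nz PK(6,7) unfolding e by (simp_all add: field_simps)
    then have M2: "\<kappa> * (t + inverse t) = r * M + s"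
      by (simp add: distrib_left)
    have "\<kappa> * (b / Q ^ d) = r" "\<kappa> * (\<rho> / \<kappa> * (Q ^ (d + 2) / M)) = \<sigma>"
      using nz PK(6,7) unfolding e by (simp_all add: field_simps)
    then have "\<kappa> * (b / Q ^ d - \<rho> / \<kappa> * (Q ^ (d + 2) / M)) = r - \<sigma>"
      by (simp only: right_diff_distrib)
    then have "\<kappa> * ((1 - M) * (b / Q ^ d - \<rho> / \<kappa> * (Q ^ (d + 2) / M))) = (1 - M) * (r - \<sigma>)"
      by (metis mult.left_commute)
    note M = M1 M2 this
    have q: "qfactor (\<kappa> / b) Q d m = [:1, - s:]" "qfactor \<rho> (inverse Q) d k' = [:1, - \<sigma>:]"
      using nz by (simp_all add: qfactor_def s_def \<sigma>_def power_inverse field_simps)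
    have "[:1, - (\<kappa> * b / Q ^ d):] * [:1, - (\<kappa> / (b * Q ^ d)):] * pcompose (F m * G k) [:0, Q\<^sup>2:] =
        [:1, - r:] * ([:1, - (\<kappa> / (b * Q ^ d)):] * pcompose (F m) [:0, Q\<^sup>2:]) * pcompose (G k) [:0, Q\<^sup>2:]"
      by (simp only: pcompose_mult mult.assoc r_def)
    also have "\<dots> = ([:1, - r:] * [:1, - (\<sigma> * M):] * [:1, - s:]) * (F m * G k')"
      unfolding F Suc G q M(2) by (simp only: ac_simps)
    finally have l: "[:1, - (\<kappa> * b / Q ^ d):] * [:1, - (\<kappa> / (b * Q ^ d)):] * pcompose (F m * G k) [:0, Q\<^sup>2:] =
      ([:1, - r:] * [:1, - (\<sigma> * M):] * [:1, - s:]) * (F m * G k')" .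
    have FG: "F (Suc m) = [:1, - s:] * F m" "G k = [:1, - \<sigma>:] * G k'" "k - 1 = k'"
      by (simp_all add: F_def G_def q Suc ac_simps del: mult_pCons_left mult_pCons_right)
    have id: "[:1, 0, r * s * M:] * [:1, - \<sigma>:] - [:1, - r:] * [:1, - (\<sigma> * M):] * [:1, - s:] =
        [:0, 1:] * (smult (r * M + s) [:1, - \<sigma>:] + smult ((1 - M) * (r - \<sigma>)) [:1, - s:])"
      by (simp add: algebra_simps)
    have "[:1, 0, \<kappa>\<^sup>2:] * (F m * G k) - ([:1, - r:] * [:1, - (\<sigma> * M):] * [:1, - s:]) * (F m * G k') =
      ([:1, 0, r * s * M:] * [:1, - \<sigma>:] - [:1, - r:] * [:1, - (\<sigma> * M):] * [:1, - s:]) * (F m * G k')"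
      unfolding FG M(1) by (simp only: algebra_simps)
    also have "\<dots> = [:0, 1:] * (smult (r * M + s) (F m * G k) + smult ((1 - M) * (r - \<sigma>)) (F (Suc m) * G k'))"
      unfolding id FG
      by (simp only: distrib_left distrib_right mult.assoc mult_smult_left) (simp only: ac_simps)
    also have "\<dots> = [:0, \<kappa>:] * (smult (t + inverse t) (F m * G k) +
       smult ((1 - M) * (b / Q ^ d - \<rho> / \<kappa> * (Q ^ (d + 2) / M))) (F (Suc m) * G k'))"
      unfolding M(3,4)[symmetric] by (simp add: smult_add_right ac_simps)
    finally show ?thesis
      unfolding l M_def FG(3) .
  qed
qed

section \<open>The tridiagonal form\<close>

lemma powi_eq_divide:
  fixes q :: "'f::field"
  assumes "q \<noteq> 0" "z = int k - int l"
  shows "q powi z = q ^ k / q ^ l"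
  using assms by (simp add: power_int_diff)

text \<open>
  The second condition of feasibility, rewritten without negative exponents: the excluded power
  \<open>q^(d + 1 - 2k)\<close> with \<open>k = i + 1\<close> is \<open>q^d / q^(2i + 1)\<close>.
\<close>

lemma feasible_nonresonant:
  fixes q :: "'f::field"
  assumes "feasible q a b c d" "q \<noteq> 0" "i < d"
  shows "a * inverse b * c * q * q ^ (2 * i) \<noteq> q ^ d" "a * b * inverse c * q * q ^ (2 * i) \<noteq> q ^ d"
proof -
  have k: "int i + 1 \<in> {1..int d}" using assms(3) by auto
  have e: "q powi (int d + 1 - 2 * (int i + 1)) = q ^ d / (q * q ^ (2 * i))"
    using powi_eq_divide[OF assms(2), of "int d + 1 - 2 * (int i + 1)" d "Suc (2 * i)"] by simp
  have "x \<noteq> q ^ d / (q * q ^ (2 * i))" if "x \<in> {a * b * c, inverse a * b * c, a * inverse b * c, a * b * inverse c}" for x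
    using assms(1) k that unfolding feasible_def e[symmetric] by blast
  then show "a * inverse b * c * q * q ^ (2 * i) \<noteq> q ^ d" "a * b * inverse c * q * q ^ (2 * i) \<noteq> q ^ d"
    using assms(2) by (force simp: eq_divide_eq mult.assoc)+
qed

text \<open>
  If the monomial of degree \<open>n\<close> is multiplied by \<open>\<Prod>\<^bsub>i<n\<^esub> g\<^sub>i\<close>, its coefficients under the two
  \<open>q\<close>-difference operators become the entries of the two tridiagonal matrices. One rescaling \<open>g\<close>
  serves both operators; this is what the value of \<open>\<kappa>\<close> is chosen for.
\<close>

lemma monomial_rescaling_identities:
  fixes q c :: "'f::field" and d i :: nat
  assumes q: "q \<noteq> 0" and c: "c \<noteq> 0" and nr: "q ^ (2 * i + 2) \<noteq> 1"
  assumes \<kappa>_def: "\<kappa> = inverse c / q ^ (d + 1)"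
    and g_def: "g = q ^ (d + 1) * (1 - q ^ (2 * i) / q ^ (2 * d)) / (1 - q ^ (2 * i + 2))"
  shows "c * (1 - q powi (2 * int d - 2 * int (i + 1) + 2)) = g * ((1 - inverse q ^ (2 * (i + 1))) / \<kappa>)"
    and "g * (inverse c * (1 - q powi (- 2 * int (i + 1)))) = \<kappa> * (1 - inverse q ^ (2 * i) / inverse q ^ (2 * d))"
    and "q powi (int d + 1) * (1 - q powi (2 * int (i + 1) - 2 * int d - 2)) = g * (1 - q ^ (2 * (i + 1)))"
    and "g * (q powi (- int d - 1) * (1 - q powi (2 * int (i + 1)))) = 1 - q ^ (2 * i) / q ^ (2 * d)"
proof -
  define E I where "E = q ^ (d + 1)" and "I = q ^ (2 * i)"
  have nz: "E \<noteq> 0" "I \<noteq> 0" "1 - I * (q * q) \<noteq> 0"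
    using q nr by (auto simp: E_def I_def ac_simps)
  have pw: "q ^ (2 * i + 2) = I * (q * q)" "q ^ (2 * (i + 1)) = I * (q * q)" "q ^ (2 * d) = E * E / (q * q)"
    using q by (simp_all add: E_def I_def mult_2 power_add)
  have pi: "q powi (2 * int d - 2 * int (i + 1) + 2) = E * E / (I * (q * q))"
    "q powi (- 2 * int (i + 1)) = 1 / (I * (q * q))"
    "q powi (int d + 1) = E" "q powi (2 * int (i + 1) - 2 * int d - 2) = I * (q * q) / (E * E)"
    "q powi (- int d - 1) = 1 / E" "q powi (2 * int (i + 1)) = I * (q * q)"
    using q powi_eq_divide[OF q, of "2 * int d - 2 * int (i + 1) + 2" "2 * d" "2 * i"]
      powi_eq_divide[OF q, of "- 2 * int (i + 1)" 0 "2 * i + 2"]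
      powi_eq_divide[OF q, of "int d + 1" "d + 1" 0]
      powi_eq_divide[OF q, of "2 * int (i + 1) - 2 * int d - 2" "2 * i" "2 * d"]
      powi_eq_divide[OF q, of "- int d - 1" 0 "d + 1"]
      powi_eq_divide[OF q, of "2 * int (i + 1)" "2 * i + 2" 0]
    by (simp_all add: E_def I_def field_simps power_mult power2_eq_square)
  note s = \<kappa>_def g_def power_inverse pi pw E_def[symmetric] I_def[symmetric]
  show "c * (1 - q powi (2 * int d - 2 * int (i + 1) + 2)) = g * ((1 - inverse q ^ (2 * (i + 1))) / \<kappa>)"
    unfolding s using q c nz by (simp add: divide_simps) (simp add: algebra_simps)
  show "g * (inverse c * (1 - q powi (- 2 * int (i + 1)))) = \<kappa> * (1 - inverse q ^ (2 * i) / inverse q ^ (2 * d))"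
    unfolding s using q c nz by (simp add: divide_simps) (simp add: algebra_simps)
  show "q powi (int d + 1) * (1 - q powi (2 * int (i + 1) - 2 * int d - 2)) = g * (1 - q ^ (2 * (i + 1)))"
    unfolding s using q c nz by (simp add: divide_simps)
  show "g * (q powi (- int d - 1) * (1 - q powi (2 * int (i + 1)))) = 1 - q ^ (2 * i) / q ^ (2 * d)"
    unfolding s using q c nz by (simp add: divide_simps)
qed

text \<open>
  The multiplier \<open>K\<^sub>i\<close> is the product of \<open>1 - q^(-2(d-i))\<close>, which is nonzero because \<open>q\<close> is not a root of
  unity, and this expression, which vanishes only at a value of \<open>abc^-1\<close> that feasibility excludes.
\<close>

lemma raising_coefficient_factorization:
  fixes q a b c :: "'f::field"
  assumes nz: "q \<noteq> 0" "a \<noteq> 0" "b \<noteq> 0" "c \<noteq> 0" and i: "i < d"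
    and \<kappa>_def: "\<kappa> = inverse c / q ^ (d + 1)"
  shows "a / inverse q ^ d - inverse b / \<kappa> * (inverse q ^ (d + 2) / inverse q ^ (2 * (d - i))) =
    inverse b * c * q ^ d / (q * q ^ (2 * i)) * (a * b * inverse c * q * q ^ (2 * i) - q ^ d)"
proof -
  define D I where "D = q ^ d" and "I = q ^ (2 * i)"
  have nz': "D \<noteq> 0" "I \<noteq> 0" using nz by (simp_all add: D_def I_def)
  have "D * D = q ^ (2 * (d - i)) * I"
    unfolding D_def I_def power_add[symmetric] using i by (intro arg_cong[where f = "(^) q"]) simp
  then have e: "q ^ d = D" "q ^ (d + 1) = q * D" "q ^ (2 * i) = I" "q ^ (d + 2) = q * q * D"
    "q ^ (2 * (d - i)) = D * D / I"
    using nz' by (simp_all add: D_def I_def mult_2 power_add)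
  show ?thesis
    unfolding \<kappa>_def power_inverse e using nz nz' by (simp add: field_simps)
qed

text \<open>
  The left side is the multiplier with which \<open>B\<close> lowers \<open>h\<^sub>i\<^sub>+\<^sub>1\<close> to \<open>h\<^sub>i\<close>, times the multiplier \<open>K\<^sub>i\<close>
  with which \<open>A\<close> raises \<open>h\<^sub>i\<close> to \<open>h\<^sub>i\<^sub>+\<^sub>1\<close>. Up to a monomial in the parameters, each of the four
  factors on the left is one of the four binomial factors of \<open>varphi\<^sub>i\<^sub>+\<^sub>1\<close>.
\<close>

lemma varphi_factorization:
  fixes q a b c :: "'f::field"
  assumes nz: "q \<noteq> 0" "a \<noteq> 0" "b \<noteq> 0" "c \<noteq> 0" and i: "i < d"
    and \<kappa>_def: "\<kappa> = inverse c / q ^ (d + 1)"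
  shows "(1 - q ^ (2 * (i + 1))) * (b / q ^ d - \<kappa> / a * (q ^ (d + 2) / q ^ (2 * (i + 1)))) *
      ((1 - inverse q ^ (2 * (d - i))) *
        (a / inverse q ^ d - inverse b / \<kappa> * (inverse q ^ (d + 2) / inverse q ^ (2 * (d - i))))) =
    varphi q a b c d (i + 1)"
proof -
  define D I where "D = q ^ d" and "I = q ^ i"
  have nz': "D \<noteq> 0" "I \<noteq> 0" using nz by (simp_all add: D_def I_def)
  have "D * D = q ^ (2 * (d - i)) * (I * I)"
    unfolding D_def I_def power_add[symmetric] using i by (intro arg_cong[where f = "(^) q"]) simp
  then have e: "q ^ d = D" "q ^ (d + 1) = q * D" "q ^ (2 * i) = I * I" "q ^ (d + 2) = q * q * D"
    "q ^ (2 * (i + 1)) = I * q * (I * q)" "q ^ (2 * (d - i)) = D * D / (I * I)"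
    using nz' by (simp_all add: D_def I_def mult_2 power_add)
  have pi: "q powi int (i + 1) = I * q" "q powi (- int (i + 1)) = 1 / (I * q)"
    "q powi (int (i + 1) - int d - 1) = I / D" "q powi (int d - int (i + 1) + 1) = D / I"
    using nz powi_eq_divide[OF nz(1), of "int (i + 1)" "i + 1" 0]
      powi_eq_divide[OF nz(1), of "- int (i + 1)" 0 "i + 1"]
      powi_eq_divide[OF nz(1), of "int (i + 1) - int d - 1" i d]
      powi_eq_divide[OF nz(1), of "int d - int (i + 1) + 1" d i]
    by (simp_all add: D_def I_def mult.commute)
  define w x y z where "w = I * q - 1 / (I * q)" and "x = I / D - D / I"
    and "y = 1 / (I * q) - a * b * c * (I / D)" and "z = 1 / (I * q) - a * b * inverse c * (I / D)"
  have f1: "1 - q ^ (2 * (i + 1)) = - (I * q) * w"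
    unfolding e w_def using nz nz' by (simp add: field_simps)
  have f2: "b / q ^ d - \<kappa> / a * (q ^ (d + 2) / q ^ (2 * (i + 1))) = - (1 / (a * c * I)) * y"
    unfolding \<kappa>_def e y_def using nz nz' by (simp add: field_simps)
  have f3: "1 - inverse q ^ (2 * (d - i)) = - (I / D) * x"
    unfolding power_inverse e x_def using nz' by (simp add: field_simps)
  have f4: "a / inverse q ^ d - inverse b / \<kappa> * (inverse q ^ (d + 2) / inverse q ^ (2 * (d - i))) =
      - (c * D * D / (b * I)) * z"
    unfolding raising_coefficient_factorization[OF nz i \<kappa>_def] e z_def using nz nz' by (simp add: field_simps)
  have f5: "varphi q a b c d (i + 1) = inverse a * inverse b * (q * D) * w * x * y * z"
    unfolding varphi_def pi e w_def x_def y_def z_def ..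
  show ?thesis
    unfolding f1 f2 f3 f4 f5 using nz nz' by (simp add: field_simps)
qed

lemma theta_eq:
  fixes q a :: "'f::field"
  assumes "q \<noteq> 0"
  shows "theta q a d n = a * q ^ (2 * n) / q ^ d + inverse (a * q ^ (2 * n) / q ^ d)"
  using powi_eq_divide[OF assms, of "2 * int n - int d" "2 * n" d]
    powi_eq_divide[OF assms, of "int d - 2 * int n" d "2 * n"]
  by (simp add: theta_def field_simps)

text \<open>
  The conditions on \<open>up\<close> and \<open>lo\<close> are the coefficients of \<open>qdiff_op_monom\<close>, corrected by the ratio \<open>g\<close>
  of consecutive rescaling constants.
\<close>

lemma qdiff_op_represents_tridiag:
  assumes nz: "\<kappa> \<noteq> 0" "b \<noteq> 0" "Q \<noteq> 0"
    and up: "\<And>i. i < d \<Longrightarrow> up (i + 1) = g i * ((1 - Q ^ (2 * (i + 1))) / \<kappa>)"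
    and lo: "\<And>i. i < d \<Longrightarrow> g i * lo (i + 1) = \<kappa> * (1 - Q ^ (2 * i) / Q ^ (2 * d))"
    and di: "\<And>n. n \<le> d \<Longrightarrow> di n = (b + inverse b) * Q ^ (2 * n) / Q ^ d"
  shows "represents smult d (\<lambda>n. monom (\<Prod>i<n. g i) n) (tridiag_mat d lo di up) (qdiff_op \<kappa> b Q d)"
  unfolding represents_tridiag_mat_iff[OF vector_space_poly]
proof (intro allI impI)
  fix n assume n: "n \<le> d"
  interpret D: Vector_Spaces.linear smult smult "qdiff_op \<kappa> b Q d" by (rule linear_qdiff_op)
  define \<gamma> where "\<gamma> n = (\<Prod>i<n. g i)" for n
  have "qdiff_op \<kappa> b Q d (monom (\<gamma> n) n) = smult (\<gamma> n) (qdiff_op \<kappa> b Q d (monom 1 n))"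
    by (simp add: smult_monom flip: D.scale)
  also have "\<dots> = monom (\<gamma> n * ((1 - Q ^ (2 * n)) / \<kappa>)) (n - 1) +
      monom (\<gamma> n * ((b + inverse b) * Q ^ (2 * n) / Q ^ d)) n +
      monom (\<gamma> n * (\<kappa> * (1 - Q ^ (2 * n) / Q ^ (2 * d)))) (n + 1)"
    unfolding qdiff_op_monom[OF nz] by (simp only: smult_add_right smult_monom)
  also have "monom (\<gamma> n * ((1 - Q ^ (2 * n)) / \<kappa>)) (n - 1) =
      (if n = 0 then 0 else smult (up n) (monom (\<gamma> (n - 1)) (n - 1)))"
  proof (cases n)
    case (Suc i)
    then have "\<gamma> n * ((1 - Q ^ (2 * n)) / \<kappa>) = \<gamma> i * (g i * ((1 - Q ^ (2 * (i + 1))) / \<kappa>))"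
      by (simp only: \<gamma>_def prod.lessThan_Suc mult.assoc) simp
    also have "\<dots> = up n * \<gamma> i"
      using up[of i] n Suc by simp
    finally show ?thesis using Suc by (simp add: smult_monom)
  qed simp
  also have "monom (\<gamma> n * ((b + inverse b) * Q ^ (2 * n) / Q ^ d)) n = smult (di n) (monom (\<gamma> n) n)"
    using di[OF n] by (simp add: smult_monom mult.commute)
  also have "monom (\<gamma> n * (\<kappa> * (1 - Q ^ (2 * n) / Q ^ (2 * d)))) (n + 1) =
      (if n < d then smult (lo (n + 1)) (monom (\<gamma> (n + 1)) (n + 1)) else 0)"
  proof (cases "n < d")
    case True
    have "\<gamma> n * (\<kappa> * (1 - Q ^ (2 * n) / Q ^ (2 * d))) = lo (n + 1) * \<gamma> (n + 1)"
      unfolding lo[OF True, symmetric] by (simp add: \<gamma>_def)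
    then show ?thesis using True by (simp only: smult_monom if_True)
  next
    case False
    then show ?thesis using n nz by simp
  qed
  finally show "qdiff_op \<kappa> b Q d (monom (\<Prod>i<n. g i) n) =
      (if n = 0 then 0 else smult (up n) (monom (\<Prod>i<n - 1. g i) (n - 1))) +
      smult (di n) (monom (\<Prod>i<n. g i) n) +
      (if n < d then smult (lo (n + 1)) (monom (\<Prod>i<n + 1. g i) (n + 1)) else 0)"
    unfolding \<gamma>_def .
qed

lemma poly_in_span_monom:
  fixes p :: "'f::field poly"
  assumes "degree p \<le> d" "\<And>n. n \<le> d \<Longrightarrow> \<gamma> n \<noteq> 0"
  shows "p \<in> module.span smult ((\<lambda>n. monom (\<gamma> n) n) ` {0..d})"
proof -
  interpret vector_space "smult :: 'f \<Rightarrow> 'f poly \<Rightarrow> 'f poly" by (rule vector_space_poly)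
  have "p = (\<Sum>n\<le>d. monom (coeff p n) n)"
    using poly_as_sum_of_monoms'[OF assms(1)] by simp
  also have "\<dots> = (\<Sum>n\<le>d. smult (coeff p n / \<gamma> n) (monom (\<gamma> n) n))"
    using assms(2) by (intro sum.cong) (auto simp: smult_monom)
  also have "\<dots> \<in> span ((\<lambda>n. monom (\<gamma> n) n) ` {0..d})"
    by (intro span_sum span_scale span_base) auto
  finally show ?thesis .
qed

lemma degree_prod_qfactor: "degree (\<Prod>i<k. qfactor \<beta> Q d i) \<le> k"
proof (induction k)
  case (Suc k)
  have "degree (qfactor \<beta> Q d k) \<le> 1"
    by (simp add: qfactor_def)
  then have "degree (\<Prod>i<k. qfactor \<beta> Q d i) + degree (qfactor \<beta> Q d k) \<le> Suc k"
    using Suc by linarith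
  then show ?case
    by (simp add: order_trans[OF degree_mult_le])
qed simp

text \<open>
  The factors belonging to \<open>a\<close> are nonzero at the roots of the factors belonging to \<open>b\<close> precisely when
  \<open>ab^-1c\<close> avoids a power of \<open>q\<close>; for \<open>i + j < d\<close> feasibility excludes this power.
\<close>

lemma qfactor_eval:
  fixes q a b c :: "'f::field"
  assumes nz: "q \<noteq> 0" "a \<noteq> 0" "b \<noteq> 0" "c \<noteq> 0"
    and \<kappa>_def: "\<kappa> = inverse c / q ^ (d + 1)"
  shows "poly (qfactor (inverse b) q d j) (b * q ^ d / q ^ (2 * j)) = 0"
    and "poly (qfactor (\<kappa> / a) (inverse q) d i) (b * q ^ d / q ^ (2 * j)) =
      1 - q ^ d / (a * inverse b * c * q * q ^ (2 * (i + j)))"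
proof -
  define D I J where "D = q ^ d" and "I = q ^ i" and "J = q ^ j"
  have nz': "D \<noteq> 0" "I \<noteq> 0" "J \<noteq> 0" using nz by (simp_all add: D_def I_def J_def)
  have e: "q ^ d = D" "q ^ (d + 1) = q * D" "q ^ (2 * i) = I * I" "q ^ (2 * j) = J * J"
    "q ^ (2 * (i + j)) = I * I * (J * J)"
    by (simp_all add: D_def I_def J_def mult_2 power_add)
  show "poly (qfactor (inverse b) q d j) (b * q ^ d / q ^ (2 * j)) = 0"
    unfolding qfactor_def e using nz nz' by simp
  show "poly (qfactor (\<kappa> / a) (inverse q) d i) (b * q ^ d / q ^ (2 * j)) =
      1 - q ^ d / (a * inverse b * c * q * q ^ (2 * (i + j)))"
    unfolding qfactor_def \<kappa>_def power_inverse e using nz nz' by (simp add: field_simps)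
qed

theorem proposition17p1:
  fixes scale :: "'f::alg_closed_field \<Rightarrow> 'v::ab_group_add \<Rightarrow> 'v"
    and A B :: "'v \<Rightarrow> 'v"
    and q a b c :: 'f and d :: nat
  assumes "vector_space scale"
    and "q \<noteq> 0"
    and "\<forall>n \<ge> 1. q ^ n \<noteq> 1"
    and "leonard_pair scale A B"
    and "q_racah_type scale q A B"
    and "d \<ge> 1"
    and "corresponds scale q A B a b c d"
  shows "\<exists>v. basis_seq scale d v \<and>
    represents scale d v
      (tridiag_mat d
         (\<lambda>n. inverse c * (1 - q powi (- 2 * int n)))
         (\<lambda>n. (a + inverse a) * q powi (int d - 2 * int n))
         (\<lambda>n. c * (1 - q powi (2 * int d - 2 * int n + 2)))) A \<and>
    represents scale d v
      (tridiag_mat d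
         (\<lambda>n. q powi (- int d - 1) * (1 - q powi (2 * int n)))
         (\<lambda>n. (b + inverse b) * q powi (2 * int n - int d))
         (\<lambda>n. q powi (int d + 1) * (1 - q powi (2 * int n - 2 * int d - 2)))) B"
    (is "\<exists>v. _ \<and> represents scale d v ?MA A \<and> represents scale d v ?MB B")
proof -
  have lin: "Vector_Spaces.linear scale scale A" "Vector_Spaces.linear scale scale B"
    using assms(4) by (auto simp: leonard_pair_def)
  from assms(7) obtain v where feas: "feasible q a b c d" and v: "basis_seq scale d v"
    "represents scale d v (lower_bidiag_mat d (\<lambda>_. 1) (theta q a d)) A"
    "represents scale d v (upper_bidiag_mat d (theta q b d) (varphi q a b c d)) B"
    unfolding corresponds_def by blast
  have nz: "q \<noteq> 0" "a \<noteq> 0" "b \<noteq> 0" "c \<noteq> 0"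
    using assms(2) feas by (auto simp: feasible_def)
  define \<kappa> where "\<kappa> = inverse c / q ^ (d + 1)"
  have \<kappa>: "\<kappa> \<noteq> 0" using nz by (simp add: \<kappa>_def)
  define DA DB where "DA = qdiff_op \<kappa> a (inverse q) d" and "DB = qdiff_op 1 b q d"
  have DA: "Vector_Spaces.linear smult smult DA" and DB: "Vector_Spaces.linear smult smult DB"
    by (simp_all add: DA_def DB_def linear_qdiff_op)
  interpret DA: Vector_Spaces.linear smult smult DA by (rule DA)
  interpret DB: Vector_Spaces.linear smult smult DB by (rule DB)
  \<comment> \<open>The split basis of the model, the multipliers \<open>K\<close> normalising its subdiagonal entries to 1.\<close>
  define p s where "p = qfactor (\<kappa> / a) (inverse q) d" and "s = qfactor (inverse b) q d"
  define K where "K i = (1 - inverse q ^ (2 * (d - i))) *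
    (a / inverse q ^ d - inverse b / \<kappa> * (inverse q ^ (d + 2) / inverse q ^ (2 * (d - i))))" for i
  define C where "C n = (\<Prod>i<n. K i)" for n
  define h where "h n = (\<Prod>i<n. p i) * (\<Prod>j<d - n. s j)" for n
  define u where "u n = smult (C n) (h n)" for n
  \<comment> \<open>The rescaled monomials, on which the operators have the required matrices.\<close>
  define g where "g i = q ^ (d + 1) * (1 - q ^ (2 * i) / q ^ (2 * d)) / (1 - q ^ (2 * i + 2))" for i
  define \<gamma> where "\<gamma> n = (\<Prod>i<n. g i)" for n
  define e where "e n = monom (\<gamma> n) n" for n

  have q_pow: "q ^ n \<noteq> 1" if "n > 0" for n
    using assms(3) that by simp
  have q_ratio: "q ^ (2 * i) / q ^ (2 * d) \<noteq> 1" if "i < d" for i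
  proof -
    have "q ^ (2 * d) = q ^ (2 * i) * q ^ (2 * (d - i))"
      using that by (simp flip: power_add distrib_left)
    then show ?thesis using q_pow[of "2 * (d - i)"] that nz by auto
  qed
  have K: "K i \<noteq> 0" if "i < d" for i
    using q_pow[of "2 * (d - i)"] feasible_nonresonant(2)[OF feas nz(1) that] that nz
    unfolding K_def raising_coefficient_factorization[OF nz that \<kappa>_def] by (simp add: power_inverse)
  then have C: "C n \<noteq> 0" if "n \<le> d" for n
    using that by (auto simp: C_def)
  have g: "g i \<noteq> 0" if "i < d" for i
    using q_ratio[OF that] q_pow[of "2 * i + 2"] nz by (simp add: g_def)
  then have \<gamma>: "\<gamma> n \<noteq> 0" if "n \<le> d" for n
    using that by (auto simp: \<gamma>_def)

  have indep: "l n = 0" if "(\<Sum>n = 0..d. smult (l n) (u n)) = 0" "n \<le> d" for l n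
  proof -
    have "l n * C n = 0"
    proof (rule mixed_products_independent[of d s "\<lambda>j. b * q ^ d / q ^ (2 * j)" p "\<lambda>n. l n * C n"])
      show "poly (p i) (b * q ^ d / q ^ (2 * j)) \<noteq> 0" if "i + j < d" for i j
        using feasible_nonresonant(1)[OF feas nz(1) that] nz
        by (simp add: p_def qfactor_eval(2)[OF nz \<kappa>_def])
      show "poly (s j) (b * q ^ d / q ^ (2 * j)) = 0" for j
        unfolding s_def by (rule qfactor_eval(1)[OF nz \<kappa>_def])
    qed (use that in \<open>auto simp: s_def qfactor_def u_def h_def\<close>)
    then show ?thesis using C[OF that(2)] by simp
  qed
  have u: "inj_on u {0..d}" "\<not> module.dependent smult (u ` {0..d})"
    using independent_family[OF vector_space_poly, where d = d and u = u] indep by blast+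

  have DAh: "DA (h n) = smult (theta q a d n) (h n) + smult (K n) (h (n + 1))" if "n \<le> d" for n
  proof -
    define t where "t = a * inverse q ^ d / inverse q ^ (2 * n)"
    have "t = a * q ^ (2 * n) / q ^ d"
      using nz by (simp add: t_def power_inverse divide_inverse)
    then have t: "t + inverse t = theta q a d n"
      by (simp add: theta_eq[OF nz(1)])
    have nz': "inverse q \<noteq> 0" using nz by simp
    show ?thesis
      using qdiff_op_prod[OF \<kappa> nz(2) nz' le_add_diff_inverse[OF that], of "inverse b"]
      unfolding t_def[symmetric] t
      by (simp add: DA_def h_def p_def s_def K_def)
  qed
  have DBh: "DB (h n) = smult (theta q b d n) (h n) + smult
     ((1 - q ^ (2 * n)) * (b / q ^ d - \<kappa> / a * (q ^ (d + 2) / q ^ (2 * n)))) (h (n - 1))" if "n \<le> d" for n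
  proof -
    define t where "t = b * q ^ d / q ^ (2 * (d - n))"
    have "q ^ d * q ^ d = q ^ (2 * (d - n)) * q ^ (2 * n)"
      unfolding power_add[symmetric] using that by (intro arg_cong[where f = "(^) q"]) simp
    then have "t = b * q ^ (2 * n) / q ^ d"
      using nz by (simp add: t_def field_simps)
    then have t: "t + inverse t = theta q b d n"
      by (simp add: theta_eq[OF nz(1)])
    have "DB ((\<Prod>j<d - n. s j) * (\<Prod>i<n. p i)) = smult (theta q b d n) ((\<Prod>j<d - n. s j) * (\<Prod>i<n. p i)) +
      smult ((1 - q ^ (2 * n)) * (b / q ^ d - \<kappa> / a * (q ^ (d + 2) / q ^ (2 * n))))
        ((\<Prod>j<Suc (d - n). s j) * (\<Prod>i<n - 1. p i))"
      using qdiff_op_prod[OF one_neq_zero nz(3,1) le_add_diff_inverse2[OF that], of "\<kappa> / a"]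
      unfolding t_def[symmetric] t
      by (simp add: DB_def p_def s_def inverse_eq_divide del: prod.lessThan_Suc)
    then show ?thesis
      using that by (cases n) (simp_all add: h_def mult.commute Suc_diff_Suc del: prod.lessThan_Suc)
  qed
  have uA: "represents smult d u (lower_bidiag_mat d (\<lambda>_. 1) (theta q a d)) DA"
    unfolding lower_bidiag_mat_def represents_tridiag_mat_iff[OF vector_space_poly]
  proof (intro allI impI)
    fix n assume n: "n \<le> d"
    \<comment> \<open>The raising term disappears at the end of the chain, so \<open>h (d + 1)\<close> does not matter.\<close>
    have "K d = 0" by (simp add: K_def)
    then show "DA (u n) = (if n = 0 then 0 else smult 0 (u (n - 1))) +
         smult (theta q a d n) (u n) + (if n < d then smult 1 (u (n + 1)) else 0)"
      using n by (auto simp: u_def DA.scale DAh smult_add_right C_def mult.commute)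
  qed
  have uB: "represents smult d u (upper_bidiag_mat d (theta q b d) (varphi q a b c d)) DB"
    unfolding upper_bidiag_mat_def represents_tridiag_mat_iff[OF vector_space_poly]
  proof (intro allI impI)
    fix n assume n: "n \<le> d"
    show "DB (u n) = (if n = 0 then 0 else smult (varphi q a b c d n) (u (n - 1))) +
         smult (theta q b d n) (u n) + (if n < d then smult 0 (u (n + 1)) else 0)"
    proof (cases n)
      case 0
      then show ?thesis by (simp add: u_def DB.scale DBh mult.commute)
    next
      case (Suc i)
      then have n_eq: "n = i + 1" and C_n: "C n = C i * K i"
        by (simp_all add: C_def)
      have vf: "(1 - q ^ (2 * (i + 1))) * (b / q ^ d - \<kappa> / a * (q ^ (d + 2) / q ^ (2 * (i + 1)))) * K i =
          varphi q a b c d (i + 1)"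
        unfolding K_def by (rule varphi_factorization[OF nz _ \<kappa>_def]) (use n Suc in simp)
      have "varphi q a b c d n * C i =
          C n * ((1 - q ^ (2 * n)) * (b / q ^ d - \<kappa> / a * (q ^ (d + 2) / q ^ (2 * n))))"
        unfolding C_n unfolding n_eq vf[symmetric] by (simp only: ac_simps)
      then show ?thesis using Suc n
        by (simp add: u_def DB.scale DBh smult_add_right mult.commute)
    qed
  qed
  note ids = monomial_rescaling_identities[OF nz(1,4) _ \<kappa>_def g_def]
  have q_suc: "q ^ (2 * i + 2) \<noteq> 1" for i by (rule q_pow) simp
  have eA: "represents smult d e ?MA DA"
    unfolding e_def \<gamma>_def DA_def
  proof (rule qdiff_op_represents_tridiag)
    show "(a + inverse a) * q powi (int d - 2 * int n) =
        (a + inverse a) * inverse q ^ (2 * n) / inverse q ^ d" for n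
      using nz powi_eq_divide[OF nz(1), of "int d - 2 * int n" d "2 * n"]
      by (simp add: power_inverse divide_inverse mult.commute)
  qed (use \<kappa> nz ids(1,2)[OF q_suc] in auto)
  have eB: "represents smult d e ?MB DB"
    unfolding e_def \<gamma>_def DB_def
  proof (rule qdiff_op_represents_tridiag)
    show "(b + inverse b) * q powi (2 * int n - int d) = (b + inverse b) * q ^ (2 * n) / q ^ d" for n
      using powi_eq_divide[OF nz(1), of "2 * int n - int d" "2 * n" d] by simp
  qed (use nz ids(3,4)[OF q_suc] in auto)
  have "u n \<in> module.span smult (e ` {0..d})" if "n \<le> d" for n
  proof -
    have "degree (h n) \<le> n + (d - n)"
      unfolding h_def p_def s_def
      by (rule order_trans[OF degree_mult_le]) (intro add_mono degree_prod_qfactor)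
    then have "degree (u n) \<le> d"
      using that order_trans[OF degree_smult_le] by (simp add: u_def)
    then show ?thesis
      using poly_in_span_monom \<gamma> unfolding e_def[abs_def] by blast
  qed
  then obtain w where "basis_seq scale d w"
    and w: "\<And>A D M N. Vector_Spaces.linear scale scale A \<Longrightarrow> Vector_Spaces.linear smult smult D \<Longrightarrow>
      represents scale d v M A \<Longrightarrow> represents smult d u M D \<Longrightarrow> represents smult d e N D \<Longrightarrow>
      represents scale d w N A"
    using transport_basis[OF assms(1) vector_space_poly v(1) u, of e] by blast
  then show ?thesis
    using w[OF lin(1) DA v(2) uA eA] w[OF lin(2) DB v(3) uB eB] by blast
qed

end
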